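(* $m_g(2,3)=7$.
   Context: For a prime power $q$, $\mathbb{P}^2(\mathbb{F}_q)$ is the projective plane over the field $\mathbb{F}_q$ with $q$ elements. A conic is the zero set in $\mathbb{P}^2(\mathbb{F}_q)$ of a nonzero homogeneous quadratic form over $\mathbb{F}_q$; it may be reducible (e.g. a union of two lines). A generalized $k$-arc is a set of $k$ points of $\mathbb{P}^2(\mathbb{F}_q)$ such that no six of them lie on a (possibly reducible) conic. It is complete if it is not contained in a generalized $(k+1)$-arc. $m_g(2,q)$ is the size of the largest complete generalized $k$-arc in $\mathbb{P}^2(\mathbb{F}_q)$. *)

theory Defs
  imports "HOL-Analysis.Cartesian_Space"
begin

text \<open>The points of the projective plane are the lines through the origin of the coordinate space.\<close>

definition proj_points :: "('a::field ^ 3) set set" where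
  "proj_points = {L. vec.subspace L \<and> vec.dim L = 1}"

definition quad_form :: "'a::field \<Rightarrow> 'a \<Rightarrow> 'a \<Rightarrow> 'a \<Rightarrow> 'a \<Rightarrow> 'a \<Rightarrow> 'a ^ 3 \<Rightarrow> 'a" where
  "quad_form a b c d e f v =
     a * (v $ 1)^2 + b * (v $ 2)^2 + c * (v $ 3)^2
     + d * (v $ 1) * (v $ 2) + e * (v $ 1) * (v $ 3) + f * (v $ 2) * (v $ 3)"

text \<open>Only the coefficient vector is required to be nonzero, so reducible and degenerate
  conics (two lines, a double line, a single point) are included.\<close>

definition is_conic :: "('a::field ^ 3) set set \<Rightarrow> bool" where
  "is_conic C \<longleftrightarrow>
     (\<exists>a b c d e f. (a, b, c, d, e, f) \<noteq> (0, 0, 0, 0, 0, 0) \<and>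
        C = {L \<in> proj_points. \<forall>v\<in>L. quad_form a b c d e f v = 0})"

definition generalized_arc :: "nat \<Rightarrow> ('a::field ^ 3) set set \<Rightarrow> bool" where
  "generalized_arc k A \<longleftrightarrow>
     A \<subseteq> proj_points \<and> finite A \<and> card A = k \<and>
     \<not> (\<exists>S C. S \<subseteq> A \<and> card S = 6 \<and> is_conic C \<and> S \<subseteq> C)"

definition complete_generalized_arc :: "nat \<Rightarrow> ('a::field ^ 3) set set \<Rightarrow> bool" where
  "complete_generalized_arc k A \<longleftrightarrow>
     generalized_arc k A \<and> \<not> (\<exists>B. generalized_arc (k + 1) B \<and> A \<subseteq> B)"

text \<open>The field with \<open>q\<close> elements enters as a type argument; over a finite field the set of
  sizes is finite and nonempty, so \<^const>\<open>Max\<close> is meaningful.\<close>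

definition m_g :: "'a::{field,finite} itself \<Rightarrow> nat" where
  "m_g _ = Max {k. \<exists>A :: ('a ^ 3) set set. complete_generalized_arc k A}"

end

theory Submission
  imports Defs
begin

text \<open>
  The lower bound comes from the seven points spanned by the unit vectors and by the vectors
  \<open>(1, \<plusminus>1, \<plusminus>1)\<close>. Over the field with three elements, the values of any quadratic form at
  these vectors satisfy one linear relation in which every coefficient is \<open>1\<close> or \<open>-1\<close>. A form
  vanishing at six of the points therefore vanishes at the seventh as well, and only the zero form
  vanishes at all seven (\<open>generalized_arc_7\<close>).

  For the upper bound, reducible conics are enough: a pair of lines is a conic, so two lines
  together carry at most five points of a generalized arc \<open>A\<close>. Suppose \<open>A\<close> has eight points.
  Then no line carries four of them, since such a line and the line joining two further points
  would form a forbidden conic. Four lines pass through each point of \<open>A\<close> and partition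
  the other seven points into classes of size at most two, so at least three of the four lines
  carry exactly three points of \<open>A\<close>. Fix \<open>P\<close> in \<open>A\<close>, three such lines through \<open>P\<close>, and the one
  point \<open>Q\<close> of \<open>A\<close> that they leave out. Some three-point line \<open>n\<close> through \<open>Q\<close> avoids \<open>P\<close>. It has to
  meet each of the three lines in a point of \<open>A\<close>, since otherwise the two lines would carry six
  points. These meeting points are distinct, but besides \<open>Q\<close> the line \<open>n\<close> contains only two points
  of \<open>A\<close> (\<open>no_8_set_with_small_line_pairs\<close>).

  Every subset of a generalized arc is a generalized arc, so excluding eight points excludes all
  larger sizes. The arc of size seven is then automatically complete.
\<close>

section \<open>The field with three elements\<close>

text \<open>The field is given only through its cardinality. These facts let identities over it be checked
  by running through the values \<open>0\<close>, \<open>1\<close>, \<open>-1\<close>.\<close>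

lemma three_elements:
  assumes "CARD('a::{field,finite}) = 3"
  shows "(1::'a) + 1 = -1" and "(1::'a) \<noteq> -1" and "\<And>x::'a. x = 0 \<or> x = 1 \<or> x = -1"
proof -
  have nontrivial: "(1::'a) + 1 \<noteq> 0"
  proof
    assume two: "(1::'a) + 1 = 0"
    have "\<exists>a::'a. a \<notin> {0, 1}"
    proof (rule ccontr)
      assume "\<nexists>a::'a. a \<notin> {0, 1}"
      then have "(UNIV :: 'a set) = {0, 1}" by blast
      then have "CARD('a) = card {0::'a, 1}" by simp
      then show False using assms by simp
    qed
    then obtain a :: 'a where a: "a \<noteq> 0" "a \<noteq> 1" by blast
    have all: "{0, 1, a} = UNIV"
      by (rule card_subset_eq) (use a assms in auto)
    have "a + 1 \<in> {0, 1, a}" using all by simp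
    moreover have "a + 1 \<noteq> 0" using a two by (metis add_right_cancel)
    moreover have "a + 1 \<noteq> 1" "a + 1 \<noteq> a" using a(1) by simp_all
    ultimately show False by blast
  qed
  then show neq: "(1::'a) \<noteq> -1" by (metis add.left_inverse)
  have all: "{0, 1, -1} = (UNIV :: 'a set)"
    by (rule card_subset_eq) (use neq assms in auto)
  then show "x = 0 \<or> x = 1 \<or> x = -1" for x :: 'a by blast
  have "(1::'a) + 1 \<in> {0, 1, -1}" using all by simp
  moreover have "(1::'a) + 1 \<noteq> 1" by (metis add_cancel_right_right zero_neq_one)
  ultimately show "(1::'a) + 1 = -1" using nontrivial by blast
qed

section \<open>Points and lines\<close>

text \<open>A line is represented by a linear form. The zero form gives the whole plane, so genuine lines
  are the elements of \<open>line ` (- {0})\<close>.\<close>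

definition line :: "'a::field ^ 3 \<Rightarrow> ('a ^ 3) set set" where
  "line w = {L \<in> proj_points. \<forall>v\<in>L. scalar_product w v = 0}"

lemma scalar_product_3:
  fixes v w :: "'a::field ^ 3"
  shows "scalar_product w v = w $ 1 * v $ 1 + w $ 2 * v $ 2 + w $ 3 * v $ 3"
  by (simp add: scalar_product_def sum_3)

lemma proj_points_iff: "L \<in> proj_points \<longleftrightarrow> (\<exists>u. u \<noteq> 0 \<and> L = vec.span {u})"
proof
  assume "L \<in> proj_points"
  then have L: "vec.subspace L" "vec.dim L = 1" by (auto simp: proj_points_def)
  obtain B where B: "B \<subseteq> L" "vec.independent B" "L \<subseteq> vec.span B" "card B = 1"
    using vec.basis_exists[of L] L(2) by metis
  then obtain u where u: "B = {u}" using card_1_singletonE by blast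
  have "L = vec.span {u}"
    using B L(1) u by (metis vec.span_minimal subset_antisym)
  moreover have "u \<noteq> 0" using B u vec.dependent_zero by blast
  ultimately show "\<exists>u. u \<noteq> 0 \<and> L = vec.span {u}" by blast
next
  assume "\<exists>u. u \<noteq> 0 \<and> L = vec.span {u}"
  then show "L \<in> proj_points" by (auto simp: proj_points_def vec.subspace_span)
qed

lemma span_eq_iff:
  assumes "v \<noteq> 0"
  shows "vec.span {v} = vec.span {u} \<longleftrightarrow> v \<in> vec.span {u}"
proof
  assume "v \<in> vec.span {u}"
  then obtain k where k: "v = k *s u" by (auto simp: vec.span_singleton)
  with assms have "k \<noteq> 0" by auto
  then have "u = inverse k *s v" using k by simp
  then have "u \<in> vec.span {v}" by (metis rangeI vec.span_singleton)
  with \<open>v \<in> vec.span {u}\<close> show "vec.span {v} = vec.span {u}"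
    by (simp add: vec.span_minimal subset_antisym vec.subspace_span)
qed (metis vec.span_base insertI1)

lemma span_in_line_iff:
  assumes "v \<noteq> 0"
  shows "vec.span {v} \<in> line w \<longleftrightarrow> scalar_product w v = 0"
proof -
  have "scalar_product w (k *s v) = k * scalar_product w v" for k
    by (simp add: scalar_product_3 algebra_simps)
  moreover have "v \<in> vec.span {v}" by (simp add: vec.span_base)
  moreover have "vec.span {v} \<in> proj_points" using assms proj_points_iff by blast
  ultimately show ?thesis by (auto simp: line_def vec.span_singleton)
qed

text \<open>The product of two linear forms is a quadratic form, and it is nonzero because a polynomial ring
  over a field has no zero divisors. In coordinates this means that the six coefficients of the
  product cannot all vanish.\<close>

lemma line_pair_subset_conic:
  assumes "w \<noteq> 0" "w' \<noteq> 0"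
  obtains C where "is_conic C" "line w \<union> line w' \<subseteq> C"
proof -
  define a where "a = w $ 1 * w' $ 1"
  define b where "b = w $ 2 * w' $ 2"
  define c where "c = w $ 3 * w' $ 3"
  define d where "d = w $ 1 * w' $ 2 + w $ 2 * w' $ 1"
  define e where "e = w $ 1 * w' $ 3 + w $ 3 * w' $ 1"
  define f where "f = w $ 2 * w' $ 3 + w $ 3 * w' $ 2"
  have "quad_form a b c d e f v = scalar_product w v * scalar_product w' v" for v
    by (simp add: quad_form_def scalar_product_3 a_def b_def c_def d_def e_def f_def
        algebra_simps power2_eq_square)
  then have "line w \<union> line w' \<subseteq> {L \<in> proj_points. \<forall>v\<in>L. quad_form a b c d e f v = 0}"
    by (auto simp: line_def)
  moreover have "(a, b, c, d, e, f) \<noteq> (0, 0, 0, 0, 0, 0)"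
  proof
    assume "(a, b, c, d, e, f) = (0, 0, 0, 0, 0, 0)"
    then have zero: "a = 0" "b = 0" "c = 0" "d = 0" "e = 0" "f = 0" by simp_all
    \<comment> \<open>At a nonzero coordinate of \<open>w\<close>, the square term makes that coordinate of \<open>w'\<close> vanish, and
      then the mixed terms make the other two vanish.\<close>
    consider "w $ 1 \<noteq> 0" | "w $ 2 \<noteq> 0" | "w $ 3 \<noteq> 0"
      using assms(1) by (auto simp: vec_eq_iff forall_3)
    then have "w' $ 1 = 0 \<and> w' $ 2 = 0 \<and> w' $ 3 = 0"
    proof cases
      case 1
      then have "w' $ 1 = 0" using zero(1) by (simp add: a_def)
      then show ?thesis using 1 zero(4,5) by (simp add: d_def e_def)
    next
      case 2
      then have "w' $ 2 = 0" using zero(2) by (simp add: b_def)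
      then show ?thesis using 2 zero(4,6) by (simp add: d_def f_def)
    next
      case 3
      then have "w' $ 3 = 0" using zero(3) by (simp add: c_def)
      then show ?thesis using 3 zero(5,6) by (simp add: e_def f_def)
    qed
    then show False using assms(2) by (simp add: vec_eq_iff forall_3)
  qed
  ultimately show thesis
    by (intro that[of "{L \<in> proj_points. \<forall>v\<in>L. quad_form a b c d e f v = 0}"])
      (unfold is_conic_def, intro exI, rule conjI, assumption, rule refl)
qed

section \<open>Pencils of lines\<close>

text \<open>The incidence properties of the lines through a point of the plane of order three, relative to
  a set \<open>X\<close> of points: the lines in \<open>M\<close> partition the points of \<open>X\<close> other than \<open>P\<close>. Bounding the
  number of lines by four is what the counting needs, and it spares a proof that they
  are distinct as point sets.\<close>

definition pencil :: "'p set \<Rightarrow> 'p \<Rightarrow> 'p set set \<Rightarrow> bool" where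
  "pencil X P M \<longleftrightarrow> finite M \<and> card M \<le> 4 \<and> (\<forall>m\<in>M. P \<in> m) \<and>
     X - {P} \<subseteq> \<Union>M \<and> (\<forall>m\<in>M. \<forall>m'\<in>M. m \<noteq> m' \<longrightarrow> X \<inter> m \<inter> m' \<subseteq> {P})"

lemma pencil_mono:
  assumes "pencil X P M" "Y \<subseteq> X"
  shows "pencil Y P M"
proof -
  have "Y - {P} \<subseteq> \<Union>M"
    using assms unfolding pencil_def by (elim conjE) (rule subset_trans[OF Diff_mono], auto)
  moreover have "Y \<inter> m \<inter> m' \<subseteq> {P}" if "m \<in> M" "m' \<in> M" "m \<noteq> m'" for m m'
  proof -
    have "X \<inter> m \<inter> m' \<subseteq> {P}" using assms(1) that unfolding pencil_def by simp
    then show ?thesis using assms(2) by blast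
  qed
  ultimately show ?thesis using assms(1) unfolding pencil_def by simp
qed

text \<open>The linear forms vanishing at a nonzero vector form a space of dimension two, and a basis of it
  determines the vector up to scaling. The basis is written down explicitly, according to the
  first nonzero coordinate of the vector.\<close>

lemma independent_forms_vanishing_at:
  fixes u :: "'a::field ^ 3"
  assumes "u \<noteq> 0"
  obtains f g where
    "\<And>v. scalar_product f v = 0 \<and> scalar_product g v = 0 \<longleftrightarrow> v \<in> vec.span {u}"
    and "f \<noteq> 0" and "\<And>k. g \<noteq> k *s f"
proof -
  have span: "v \<in> vec.span {u} \<longleftrightarrow> (\<exists>k. v $ 1 = k * u $ 1 \<and> v $ 2 = k * u $ 2 \<and> v $ 3 = k * u $ 3)" for v
    by (auto simp: vec.span_singleton vec_eq_iff forall_3)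
  consider "u $ 1 \<noteq> 0" | "u $ 1 = 0" "u $ 2 \<noteq> 0" | "u $ 1 = 0" "u $ 2 = 0" "u $ 3 \<noteq> 0"
    using assms by (auto simp: vec_eq_iff forall_3)
  then show thesis
  proof cases
    case 1
    show thesis
    proof (rule that[of "vector [u $ 2, - u $ 1, 0]" "vector [u $ 3, 0, - u $ 1]"])
      fix v
      show "scalar_product (vector [u $ 2, - u $ 1, 0]) v = 0 \<and>
            scalar_product (vector [u $ 3, 0, - u $ 1]) v = 0 \<longleftrightarrow> v \<in> vec.span {u}"
        (is "?l \<longleftrightarrow> _")
      proof
        assume ?l
        then show "v \<in> vec.span {u}" unfolding span
          by (intro exI[of _ "v $ 1 / u $ 1"]) (use 1 in \<open>auto simp: scalar_product_3 field_simps\<close>)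
      qed (auto simp: span scalar_product_3)
    qed (use 1 in \<open>auto simp: vec_eq_iff forall_3\<close>)
  next
    case 2
    show thesis
    proof (rule that[of "vector [1, 0, 0]" "vector [0, u $ 3, - u $ 2]"])
      fix v
      show "scalar_product (vector [1, 0, 0]) v = 0 \<and>
            scalar_product (vector [0, u $ 3, - u $ 2]) v = 0 \<longleftrightarrow> v \<in> vec.span {u}"
        (is "?l \<longleftrightarrow> _")
      proof
        assume ?l
        then show "v \<in> vec.span {u}" unfolding span
          by (intro exI[of _ "v $ 2 / u $ 2"]) (use 2 in \<open>auto simp: scalar_product_3 field_simps\<close>)
      qed (use 2 in \<open>auto simp: span scalar_product_3\<close>)
    qed (use 2 in \<open>auto simp: vec_eq_iff forall_3\<close>)
  next
    case 3
    show thesis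
    proof (rule that[of "vector [1, 0, 0]" "vector [0, 1, 0]"])
      fix v
      show "scalar_product (vector [1, 0, 0]) v = 0 \<and>
            scalar_product (vector [0, 1, 0]) v = 0 \<longleftrightarrow> v \<in> vec.span {u}"
        (is "?l \<longleftrightarrow> _")
      proof
        assume ?l
        then show "v \<in> vec.span {u}" unfolding span
          by (intro exI[of _ "v $ 3 / u $ 3"]) (use 3 in \<open>auto simp: scalar_product_3 field_simps\<close>)
      qed (use 3 in \<open>auto simp: span scalar_product_3\<close>)
    qed (use 3 in \<open>auto simp: vec_eq_iff forall_3\<close>)
  qed
qed

text \<open>If \<open>f\<close> and \<open>g\<close> are independent forms vanishing at \<open>P\<close>, the four lines through \<open>P\<close> are given by
  \<open>f\<close>, \<open>g\<close>, \<open>f + g\<close> and \<open>f - g\<close>. They cover the plane because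
  \<open>x * y * (x + y) * (x - y) = x\<^sup>3 * y - x * y\<^sup>3\<close> vanishes identically over the field with three
  elements. If two of the four forms vanish at a vector, then so do \<open>f\<close> and \<open>g\<close>, and the vector
  spans \<open>P\<close>.\<close>

lemma pencil_exists:
  fixes P :: "('a::{field,finite} ^ 3) set"
  assumes q: "CARD('a) = 3" and P: "P \<in> proj_points"
  obtains M where "M \<subseteq> line ` (- {0})" "pencil proj_points P M"
proof -
  note F3 = three_elements[OF q]
  obtain u where u: "u \<noteq> 0" "P = vec.span {u}" using P proj_points_iff by blast
  obtain f g where kernel:
      "\<And>v. scalar_product f v = 0 \<and> scalar_product g v = 0 \<longleftrightarrow> v \<in> vec.span {u}"
    and f: "f \<noteq> 0" and g: "\<And>k. g \<noteq> k *s f"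
    using independent_forms_vanishing_at[OF u(1)] by metis
  define W where "W = {f, g, f + g, f - g}"
  have add: "scalar_product (f + g) v = scalar_product f v + scalar_product g v"
    and diff: "scalar_product (f - g) v = scalar_product f v - scalar_product g v" for v
    by (simp_all add: scalar_product_3 algebra_simps)
  have two: "x + x = 0 \<longleftrightarrow> x = 0" for x :: 'a
    using F3(1,2) F3(3)[of x] by auto
  have "g \<noteq> 0" using g[of 0] by simp
  moreover have "f + g \<noteq> 0" using g[of "-1"] by (auto simp: add_eq_0_iff)
  moreover have "f - g \<noteq> 0" using g[of 1] by auto
  ultimately have "line ` W \<subseteq> line ` (- {0})" using f by (auto simp: W_def)
  moreover have "pencil proj_points P (line ` W)"
    unfolding pencil_def
  proof (intro conjI)
    show "finite (line ` W)" by (simp add: W_def)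
    have "card W \<le> 4"
      using card_length[of "[f, g, f + g, f - g]"] by (simp add: W_def)
    then show "card (line ` W) \<le> 4"
      using card_image_le[of W line] by (simp add: W_def)
    have "u \<in> vec.span {u}" by (simp add: vec.span_base)
    then have "scalar_product f u = 0" "scalar_product g u = 0" using kernel by auto
    then show "\<forall>m\<in>line ` W. P \<in> m"
      by (auto simp: W_def u span_in_line_iff add diff)
  next
    show "proj_points - {P} \<subseteq> \<Union>(line ` W)"
    proof
      fix Q :: "('a ^ 3) set" assume "Q \<in> proj_points - {P}"
      then obtain v where v: "v \<noteq> 0" "Q = vec.span {v}" using proj_points_iff by blast
      have "\<exists>w\<in>W. scalar_product w v = 0"
        unfolding W_def bex_simps add diff
        using F3(3)[of "scalar_product f v"] F3(3)[of "scalar_product g v"] by auto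
      then show "Q \<in> \<Union>(line ` W)" using v span_in_line_iff by blast
    qed
  next
    have "Q = P" if w: "w \<in> W" "w' \<in> W" "w \<noteq> w'" and Q: "Q \<in> line w" "Q \<in> line w'" for w w' Q
    proof -
      obtain v where v: "v \<noteq> 0" "Q = vec.span {v}"
        using Q(1) proj_points_iff unfolding line_def by blast
      define x where "x = scalar_product f v"
      define y where "y = scalar_product g v"
      have "scalar_product w v = 0" "scalar_product w' v = 0"
        using Q v span_in_line_iff by blast+
      then have "x = 0 \<and> y = 0"
        using w two[of x] two[of y] unfolding W_def
        by (auto simp: add diff x_def[symmetric] y_def[symmetric] add_eq_0_iff)
      then have "v \<in> vec.span {u}" using kernel by (simp add: x_def y_def)
      then show "Q = P" using span_eq_iff[OF v(1)] v(2) u(2) by simp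
    qed
    then show "\<forall>m\<in>line ` W. \<forall>m'\<in>line ` W. m \<noteq> m' \<longrightarrow> proj_points \<inter> m \<inter> m' \<subseteq> {P}"
      by blast
  qed
  ultimately show thesis by (rule that)
qed

section \<open>No generalized 8-arc\<close>

lemma card_le_5_on_line_pair:
  assumes "generalized_arc k A" "l \<in> line ` (- {0})" "l' \<in> line ` (- {0})"
  shows "card (A \<inter> (l \<union> l')) \<le> 5"
proof (rule ccontr)
  assume "\<not> card (A \<inter> (l \<union> l')) \<le> 5"
  then have "6 \<le> card (A \<inter> (l \<union> l'))" by simp
  then obtain S where S: "S \<subseteq> A \<inter> (l \<union> l')" "card S = 6"
    by (meson obtain_subset_with_card_n)
  obtain w w' where w: "w \<noteq> 0" "w' \<noteq> 0" and l: "l = line w" "l' = line w'"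
    using assms(2,3) by blast
  obtain C where "is_conic C" "l \<union> l' \<subseteq> C"
    unfolding l using line_pair_subset_conic[OF w] .
  moreover have "S \<subseteq> A" "S \<subseteq> C" using S(1) \<open>l \<union> l' \<subseteq> C\<close> by blast+
  ultimately have "\<exists>S C. S \<subseteq> A \<and> card S = 6 \<and> is_conic C \<and> S \<subseteq> C"
    using S(2) by (intro exI[of _ S] exI[of _ C] conjI)
  moreover have "\<not> (\<exists>S C. S \<subseteq> A \<and> card S = 6 \<and> is_conic C \<and> S \<subseteq> C)"
    using assms(1) unfolding generalized_arc_def by (elim conjE)
  ultimately show False by contradiction
qed

text \<open>The combinatorial core of the upper bound, with the geometry reduced to pencils and to the bound
  on pairs of lines. The case \<open>l = l'\<close> of that bound is included: it limits a single line to five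
  points before the sharper limit of three is derived.\<close>

lemma no_8_set_with_small_line_pairs:
  fixes A :: "'p set" and Lines :: "'p set set"
  assumes A: "card A = 8"
    and pairs: "\<And>l l'. l \<in> Lines \<Longrightarrow> l' \<in> Lines \<Longrightarrow> card (A \<inter> (l \<union> l')) \<le> 5"
    and pencil: "\<And>P. P \<in> A \<Longrightarrow> \<exists>M\<subseteq>Lines. pencil A P M"
  shows False
proof -
  have fin: "finite A" by (rule card_ge_0_finite) (simp add: A)
  have le3: "card (A \<inter> l) \<le> 3" if l: "l \<in> Lines" for l
  proof (rule ccontr)
    assume "\<not> card (A \<inter> l) \<le> 3"
    then have big: "4 \<le> card (A \<inter> l)" by simp
    have "card (A - l) \<ge> 3"
    proof -
      have "card (A \<inter> l) \<le> 5" using pairs[OF l l] by simp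
      moreover have "card A = card (A \<inter> l) + card (A - l)" using fin by (rule card_Int_Diff)
      ultimately show ?thesis using A by simp
    qed
    then have "2 \<le> card (A - l)" by simp
    then obtain T where T: "T \<subseteq> A - l" "card T = 2"
      by (meson obtain_subset_with_card_n)
    then obtain P Q where PQ: "T = {P, Q}" "P \<noteq> Q" by (meson card_2_iff)
    then have "P \<in> A" "Q \<in> A - {P}" using T by auto
    obtain M where M: "M \<subseteq> Lines" "pencil A P M" using pencil[OF \<open>P \<in> A\<close>] by blast
    have "Q \<in> \<Union>M" using M(2) \<open>Q \<in> A - {P}\<close> by (auto simp: pencil_def)
    then obtain l' where l': "l' \<in> M" "Q \<in> l'" by blast
    then have l': "l' \<in> Lines" "P \<in> l'" "Q \<in> l'" using M by (auto simp: pencil_def)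
    have "(A \<inter> l) \<union> T \<subseteq> A \<inter> (l \<union> l')" using T PQ l' by auto
    then have "card ((A \<inter> l) \<union> T) \<le> card (A \<inter> (l \<union> l'))" using fin by (simp add: card_mono)
    moreover have "card ((A \<inter> l) \<union> T) = card (A \<inter> l) + card T"
      using T fin PQ by (intro card_Un_disjoint) auto
    ultimately show False using big T(2) pairs[OF l l'(1)] by simp
  qed
  \<comment> \<open>Seven points in at most four classes of size at most two leave at least three full classes.\<close>
  have star: "\<exists>M N. M \<subseteq> Lines \<and> pencil A P M \<and> N \<subseteq> M \<and> card N = 3 \<and> (\<forall>m\<in>N. card (A \<inter> m - {P}) = 2)"
    if P: "P \<in> A" for P
  proof -
    obtain M where M_Lines: "M \<subseteq> Lines" and pM: "pencil A P M" using pencil[OF P] by blast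
    then have M: "finite M" "card M \<le> 4" "\<forall>m\<in>M. P \<in> m" "A - {P} \<subseteq> \<Union>M"
      by (auto simp: pencil_def)
    define N where "N = {m \<in> M. card (A \<inter> m - {P}) = 2}"
    have disj: "(A \<inter> m - {P}) \<inter> (A \<inter> m' - {P}) = {}" if "m \<in> M" "m' \<in> M" "m \<noteq> m'" for m m'
      using that pM unfolding pencil_def by blast
    have at_most: "card (A \<inter> m - {P}) \<le> 2" if "m \<in> M" for m
      using le3[of m] that M M_Lines P fin by (auto simp: card_Diff_singleton)
    have "A - {P} = (\<Union>m\<in>M. A \<inter> m - {P})" using M(4) by blast
    then have "card (A - {P}) = card (\<Union>m\<in>M. A \<inter> m - {P})" by simp
    also have "\<dots> = (\<Sum>m\<in>M. card (A \<inter> m - {P}))"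
      using disj M fin by (intro card_UN_disjoint) auto
    finally have seven: "(\<Sum>m\<in>M. card (A \<inter> m - {P})) = 7" using A P by simp
    \<comment> \<open>A class outside \<open>N\<close> has at most one element, and one inside \<open>N\<close> has two.\<close>
    have "(\<Sum>m\<in>M. card (A \<inter> m - {P})) \<le> (\<Sum>m\<in>M. 1 + (if m \<in> N then 1 else 0))"
      using at_most by (intro sum_mono) (fastforce simp: N_def)
    also have "\<dots> = card M + card N"
      using M by (simp only: sum.distrib) (simp add: N_def sum.If_cases Int_def conj_commute)
    finally have "3 \<le> card N" using seven M by simp
    then obtain N' where "N' \<subseteq> N" "card N' = 3" by (meson obtain_subset_with_card_n)
    then show ?thesis using M_Lines pM unfolding N_def
      by (intro exI[of _ M] exI[of _ N']) auto
  qed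
  obtain P where P: "P \<in> A" using A by fastforce
  obtain M N where M: "M \<subseteq> Lines" "pencil A P M"
    and N: "N \<subseteq> M" "card N = 3" "\<forall>m\<in>N. card (A \<inter> m - {P}) = 2"
    using star[OF P] by blast
  have through_P: "\<forall>m\<in>M. P \<in> m" "finite M" using M by (auto simp: pencil_def)
  have finN: "finite N" using N(1) through_P(2) by (rule finite_subset)
  have "card (\<Union>m\<in>N. A \<inter> m - {P}) \<le> (\<Sum>m\<in>N. card (A \<inter> m - {P}))"
    using finN by (rule card_UN_le)
  also have "\<dots> = 6" using N by simp
  finally have "card (\<Union>m\<in>N. A \<inter> m - {P}) < card (A - {P})" using A P by simp
  then have "\<not> A - {P} \<subseteq> (\<Union>m\<in>N. A \<inter> m - {P})"
    using finN fin by (metis card_mono finite_UN_I finite_Diff finite_Int leD)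
  then obtain Q where Q: "Q \<in> A" "Q \<noteq> P" "\<forall>m\<in>N. Q \<notin> m" by blast
  obtain K L where K: "K \<subseteq> Lines" "pencil A Q K"
    and L: "L \<subseteq> K" "card L = 3" "\<forall>m\<in>L. card (A \<inter> m - {Q}) = 2"
    using star[OF Q(1)] by blast
  \<comment> \<open>At most one line of the pencil at \<open>Q\<close> passes through \<open>P\<close>.\<close>
  obtain n where n: "n \<in> L" "P \<notin> n"
  proof -
    have unique: "m = m'" if "m \<in> L" "m' \<in> L" "P \<in> m" "P \<in> m'" for m m'
      using that K(2) L(1) P Q(2) unfolding pencil_def by blast
    have "\<exists>m\<in>L. P \<notin> m"
    proof (rule ccontr)
      assume "\<not> (\<exists>m\<in>L. P \<notin> m)"
      moreover obtain m where "m \<in> L" using L(2) by fastforce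
      ultimately have "L \<subseteq> {m}" by (metis insertI1 subsetI unique)
      then show False using L(2) card_mono[of "{m}" L] by simp
    qed
    then show thesis using that by blast
  qed
  have nL: "n \<in> Lines" "Q \<in> n" using n L K by (auto simp: pencil_def)
  have meets: "card (A \<inter> n \<inter> m) \<ge> 1" if m: "m \<in> N" for m
  proof (rule ccontr)
    assume "\<not> card (A \<inter> n \<inter> m) \<ge> 1"
    then have "A \<inter> n \<inter> m = {}" using fin by (simp add: not_le)
    then have "card ((A \<inter> n) \<union> (A \<inter> m)) = card (A \<inter> n) + card (A \<inter> m)"
      using fin by (intro card_Un_disjoint) auto
    moreover have "card (A \<inter> n) = 3"
      using L(3) n nL Q fin card_Suc_Diff1[of "A \<inter> n" Q] by auto
    moreover have "P \<in> m" using m N(1) through_P by blast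
    then have "card (A \<inter> m) = 3"
      using N m P through_P fin card_Suc_Diff1[of "A \<inter> m" P] by auto
    ultimately have "card (A \<inter> (n \<union> m)) = 6" by (simp add: Int_Un_distrib)
    then show False using pairs[of n m] nL m N(1) M(1) by auto
  qed
  have "3 \<le> (\<Sum>m\<in>N. card (A \<inter> n \<inter> m))"
    using sum_mono[of N "\<lambda>_. 1" "\<lambda>m. card (A \<inter> n \<inter> m)"] meets N(2) by simp
  also have "\<dots> = card (\<Union>m\<in>N. A \<inter> n \<inter> m)"
  proof (rule card_UN_disjoint[symmetric])
    show "\<forall>m\<in>N. \<forall>m'\<in>N. m \<noteq> m' \<longrightarrow> (A \<inter> n \<inter> m) \<inter> (A \<inter> n \<inter> m') = {}"
      using M(2) N(1) n(2) unfolding pencil_def by blast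
  qed (use finN fin in auto)
  also have "\<dots> \<le> card (A \<inter> n - {Q})"
    using Q fin by (intro card_mono) auto
  finally show False using L(3) n(1) by simp
qed

lemma generalized_arc_subset:
  assumes "generalized_arc k A" "B \<subseteq> A"
  shows "generalized_arc (card B) B"
proof -
  have A: "A \<subseteq> proj_points" "finite A"
    using assms(1) by (simp_all only: generalized_arc_def)
  have "\<not> (\<exists>S C. S \<subseteq> A \<and> card S = 6 \<and> is_conic C \<and> S \<subseteq> C)"
    using assms(1) unfolding generalized_arc_def by (elim conjE)
  then have "\<not> (\<exists>S C. S \<subseteq> B \<and> card S = 6 \<and> is_conic C \<and> S \<subseteq> C)"
    by (rule contrapos_nn) (elim exE conjE, intro exI conjI subset_trans[OF _ assms(2)])
  moreover have "B \<subseteq> proj_points" "finite B"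
    using A assms(2) by (auto intro: finite_subset)
  ultimately show ?thesis unfolding generalized_arc_def by (intro conjI refl)
qed

lemma generalized_arc_le_7:
  fixes A :: "('a::{field,finite} ^ 3) set set"
  assumes q: "CARD('a) = 3" and "generalized_arc k A"
  shows "k \<le> 7"
proof (rule ccontr)
  assume "\<not> k \<le> 7"
  then have "8 \<le> card A" using assms(2) by (simp only: generalized_arc_def)
  then obtain B where B: "B \<subseteq> A" "card B = 8" by (meson obtain_subset_with_card_n)
  then have arc: "generalized_arc 8 B" using generalized_arc_subset[OF assms(2)] by metis
  show False
  proof (rule no_8_set_with_small_line_pairs[OF B(2)])
    show "card (B \<inter> (l \<union> l')) \<le> 5" if "l \<in> line ` (- {0})" "l' \<in> line ` (- {0})" for l l'
      using card_le_5_on_line_pair[OF arc that] .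
    fix P assume "P \<in> B"
    have pts: "B \<subseteq> proj_points" using arc by (simp only: generalized_arc_def)
    with \<open>P \<in> B\<close> have "P \<in> proj_points" by blast
    from pencil_exists[OF q this] obtain M where "M \<subseteq> line ` (- {0})" "pencil proj_points P M" .
    then show "\<exists>M\<subseteq>line ` (- {0}). pencil B P M" using pencil_mono[OF _ pts] by auto
  qed
qed

section \<open>A generalized 7-arc\<close>

definition arc_vectors :: "('a::field ^ 3) set" where
  "arc_vectors = {vector [1, 0, 0], vector [0, 1, 0], vector [0, 0, 1],
     vector [1, 1, 1], vector [1, -1, -1], vector [1, -1, 1], vector [1, 1, -1]}"

text \<open>Evaluating quadratic forms at the seven vectors maps the six-dimensional space of forms into a
  seven-dimensional space. The map is injective, and its image is the hyperplane cut out by a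
  relation with no zero coefficient. A vector of that hyperplane with six zero coordinates is zero,
  which rules out all seven six-element subsets at once.\<close>

lemma generalized_arc_7:
  assumes q: "CARD('a::{field,finite}) = 3"
  shows "generalized_arc 7 ((\<lambda>v. vec.span {v}) ` (arc_vectors :: ('a ^ 3) set))"
proof -
  note F3 = three_elements[OF q]
  define V where "V = (arc_vectors :: ('a ^ 3) set)"
  define pt where "pt = (\<lambda>v::'a ^ 3. vec.span {v})"
  have neq: "(-1::'a) \<noteq> 1" using F3(2) by metis
  have nz: "v \<noteq> 0" if "v \<in> V" for v
    using that by (auto simp: V_def arc_vectors_def vec_eq_iff forall_3)
  \<comment> \<open>The first nonzero coordinate of each vector is 1, so proportional ones are equal.\<close>
  have normalized: "v $ 1 = 1 \<or> v $ 1 = 0 \<and> v $ 2 = 1 \<or> v $ 1 = 0 \<and> v $ 2 = 0 \<and> v $ 3 = 1"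
    if "v \<in> V" for v
    using that by (auto simp: V_def arc_vectors_def)
  have inj: "inj_on pt V"
  proof (rule inj_onI)
    fix u v assume uv: "u \<in> V" "v \<in> V" "pt u = pt v"
    then have "u \<in> vec.span {v}" using nz span_eq_iff pt_def by metis
    then obtain k where "u = k *s v" by (auto simp: vec.span_singleton)
    moreover from this have "k = 1"
      using normalized[OF uv(1)] normalized[OF uv(2)] by auto
    ultimately show "u = v" by simp
  qed
  have cardV: "card V = 7"
    using F3(2) neq by (auto simp: V_def arc_vectors_def vec_eq_iff forall_3 card_insert_if)
  have finV: "finite V" by (simp add: V_def arc_vectors_def)
  have "pt ` V \<subseteq> proj_points" using nz proj_points_iff pt_def by blast
  moreover have "card (pt ` V) = 7" using inj cardV by (simp add: card_image)
  moreover have False if S: "S \<subseteq> pt ` V" "card S = 6" and C: "is_conic C" "S \<subseteq> C" for S C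
  proof -
    obtain a b c d e f where nonzero: "(a, b, c, d, e, f) \<noteq> (0, 0, 0, 0, 0, 0)"
      and Ceq: "C = {L \<in> proj_points. \<forall>v\<in>L. quad_form a b c d e f v = 0}"
      using C(1) unfolding is_conic_def by blast
    define Q where "Q = quad_form a b c d e f"
    obtain U where U: "U \<subseteq> V" "S = pt ` U" using S(1) by (auto simp: subset_image_iff)
    have "card U = 6" using U S(2) inj by (metis card_image inj_on_subset)
    then have "card (V - U) = 1" using U finV cardV by (simp add: card_Diff_subset finite_subset)
    then obtain v0 where v0: "V - U = {v0}" using card_1_singletonE by blast
    have zero: "Q v = 0" if "v \<in> V" "v \<noteq> v0" for v
    proof -
      have "pt v \<in> C" using that v0 U C(2) by blast
      then show ?thesis using Ceq Q_def pt_def vec.span_base by blast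
    qed
    have "(3::'a) = (1 + 1) + 1" by simp
    also have "\<dots> = 0" by (simp only: F3(1) add.left_inverse)
    finally have three: "(3::'a) = 0" .
    \<comment> \<open>For every quadratic form, the sum over the four sign vectors is four times the sum over the
      three unit vectors: the mixed terms cancel. In characteristic 3 the factor 4 is 1.\<close>
    have relation: "Q (vector [1, 0, 0]) + Q (vector [0, 1, 0]) + Q (vector [0, 0, 1]) =
      Q (vector [1, 1, 1]) + Q (vector [1, -1, -1]) + Q (vector [1, -1, 1]) + Q (vector [1, 1, -1])"
      by (simp add: Q_def quad_form_def algebra_simps three)
    have all: "Q v = 0" if "v \<in> V" for v
    proof -
      obtain p1 p2 p3 p4 p5 p6 p7 where V: "V = {p1, p2, p3, p4, p5, p6, p7}"
        and sum: "Q p1 + Q p2 + Q p3 = Q p4 + Q p5 + Q p6 + Q p7"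
        using relation unfolding V_def arc_vectors_def by blast
      have "distinct [p1, p2, p3, p4, p5, p6, p7]"
        by (rule card_distinct) (use cardV V in simp)
      moreover have "v0 \<in> {p1, p2, p3, p4, p5, p6, p7}" using v0 V by blast
      moreover have "\<forall>p\<in>{p1, p2, p3, p4, p5, p6, p7}. p = v0 \<or> Q p = 0"
        using zero V by blast
      ultimately have "Q v0 = 0" using sum by (elim insertE emptyE) auto
      then show ?thesis using zero that by metis
    qed
    have "a = 0" "b = 0" "c = 0"
      using all[of "vector [1, 0, 0]"] all[of "vector [0, 1, 0]"] all[of "vector [0, 0, 1]"]
      by (simp_all add: V_def arc_vectors_def Q_def quad_form_def)
    moreover from this have "d + e + f = 0" "d + e = f" "d + f = e" "e + f = d"
      using all[of "vector [1, 1, 1]"] all[of "vector [1, 1, -1]"]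
        all[of "vector [1, -1, 1]"] all[of "vector [1, -1, -1]"]
      by (simp_all add: V_def arc_vectors_def Q_def quad_form_def algebra_simps)
    then have "d = 0" "e = 0" "f = 0"
      using F3(1,2) F3(3)[of d] F3(3)[of e] F3(3)[of f] neq by auto
    ultimately show False using nonzero by simp
  qed
  ultimately show ?thesis using finV unfolding generalized_arc_def V_def pt_def by blast
qed

theorem proposition3:
  assumes "CARD('a::{field,finite}) = 3"
  shows "m_g TYPE('a) = 7"
proof -
  let ?K = "{k. \<exists>A :: ('a ^ 3) set set. complete_generalized_arc k A}"
  have bound: "k \<le> 7" if "k \<in> ?K" for k
    using that generalized_arc_le_7[OF assms] by (auto simp: complete_generalized_arc_def)
  have "\<not> generalized_arc (7 + 1) B" for B :: "('a ^ 3) set set"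
    using generalized_arc_le_7[OF assms, of "7 + 1" B] by auto
  then have "7 \<in> ?K"
    using generalized_arc_7[OF assms] unfolding complete_generalized_arc_def by blast
  moreover have "finite ?K" using bound finite_subset[of ?K "{..7}"] by auto
  ultimately show ?thesis unfolding m_g_def using bound by (intro Max_eqI) auto
qed

end
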